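(* For $t>0$ put $$s_t=\frac{1-4t^4}{2t^2},\qquad \zeta_t=\frac{4-s_t^2+4is_t}{4+s_t^2}.$$ Whenever $$0\le\rho\le1,\qquad \frac1{10}\le t\le\frac{18}{25},\qquad c=\rho\zeta_t,$$ every bounded operator $T$ on a complex Hilbert space with $W(T)\subset\mathcal S_{\pi/4}=\{re^{i\theta}:r\ge0,\ |\theta|\le\pi/4\}$ satisfies $$\Bigl\|\bigl((T^2-I)^2+\bar c(T^2+I)^2\bigr)\bigl((T^2+I)^2+c(T^2-I)^2\bigr)^{-1}\Bigr\|\le\sqrt2 .$$ The same assertion holds with $c$ replaced by $\bar c$. At $\rho=1$ the quotient is understood after cancellation of its common polynomial factor. Moreover, $s_t$ decreases from $2499/50$ at $t=1/10$ through $0$ at $t=1/\sqrt2$, and the two arcs $\{\zeta_t:\frac1{10}\le t\le\frac{18}{25}\}$ and $\{\overline{\zeta_t}:\frac1{10}\le t\le\frac{18}{25}\}$ cover the unit circle except for the arc centred at $-1$ of angular length $4\arctan\frac{100}{2499}$; every radial segment below the covered arcs is admissible.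
   Context: $W(T)=\{\langle Tx,x\rangle:\|x\|=1\}$ is the numerical range. Note $|\zeta_t|=1$; when $|c|=1$ the numerator is a scalar multiple of the denominator, and the quotient after cancellation is the corresponding constant. "Every radial segment below the covered arcs is admissible" means that the norm inequality holds for all $c=\rho\zeta$, $0\le\rho\le1$, with $\zeta$ in the covered arcs. *)

theory Defs
  imports "HOL-Analysis.Analysis" "HOL-Computational_Algebra.Computational_Algebra"
    "HOL-Computational_Algebra.Field_as_Ring"
begin

section \<open>Complex Hilbert spaces\<close>

text \<open>
  The underlying real inner product is the real part of the complex one, so that the norm
  inherited from \<^class>\<open>real_inner\<close> is the Hilbert space norm. The complex inner product is
  linear in its first argument and conjugate linear in its second. The space is not assumed to be
  separable, infinite-dimensional or nonzero.
\<close>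

class chilbert_space = real_inner + complete_space +
  fixes scaleC :: "complex \<Rightarrow> 'a \<Rightarrow> 'a" (infixr \<open>*\<^sub>C\<close> 75)
    and cinner :: "'a \<Rightarrow> 'a \<Rightarrow> complex"
  assumes scaleC_add_right: "a *\<^sub>C (x + y) = a *\<^sub>C x + a *\<^sub>C y"
    and scaleC_add_left: "(a + b) *\<^sub>C x = a *\<^sub>C x + b *\<^sub>C x"
    and scaleC_scaleC: "a *\<^sub>C b *\<^sub>C x = (a * b) *\<^sub>C x"
    and scaleC_of_real: "complex_of_real r *\<^sub>C x = r *\<^sub>R x"
    and cinner_commute: "cinner x y = cnj (cinner y x)"
    and cinner_add_left: "cinner (x + y) z = cinner x z + cinner y z"
    and cinner_scaleC_left: "cinner (a *\<^sub>C x) y = a * cinner x y"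
    and inner_eq_Re_cinner: "inner x y = Re (cinner x y)"

subclass (in chilbert_space) banach ..

instantiation complex :: chilbert_space
begin

definition scaleC_complex :: "complex \<Rightarrow> complex \<Rightarrow> complex"
  where "scaleC_complex a x = a * x"

definition cinner_complex :: "complex \<Rightarrow> complex \<Rightarrow> complex"
  where "cinner_complex x y = x * cnj y"

instance
  by standard
    (simp_all add: scaleC_complex_def cinner_complex_def algebra_simps inner_complex_def
      scaleR_conv_of_real)

end

section \<open>Operators\<close>

definition bounded_clinear :: "('a::chilbert_space \<Rightarrow> 'b::chilbert_space) \<Rightarrow> bool"
  where "bounded_clinear T \<longleftrightarrow> bounded_linear T \<and> (\<forall>a x. T (a *\<^sub>C x) = a *\<^sub>C T x)"

definition numerical_range :: "('a::chilbert_space \<Rightarrow> 'a) \<Rightarrow> complex set"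
  where "numerical_range T = {cinner (T x) x | x. norm x = 1}"

definition sector :: "real \<Rightarrow> complex set"
  where "sector \<phi> = {complex_of_real r * cis \<theta> | r \<theta>. 0 \<le> r \<and> \<bar>\<theta>\<bar> \<le> \<phi>}"

text \<open>Invertibility in the algebra of bounded operators; the inverse is then \<^term>\<open>inv D\<close>.\<close>

definition op_invertible :: "('a::chilbert_space \<Rightarrow> 'a) \<Rightarrow> bool"
  where "op_invertible D \<longleftrightarrow>
    bounded_clinear D \<and> (\<exists>R. bounded_clinear R \<and> R \<circ> D = id \<and> D \<circ> R = id)"

definition op_poly :: "complex poly \<Rightarrow> ('a::chilbert_space \<Rightarrow> 'a) \<Rightarrow> 'a \<Rightarrow> 'a"
  where "op_poly p T = (\<lambda>x. \<Sum>i\<le>degree p. coeff p i *\<^sub>C (T ^^ i) x)"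

section \<open>The quotient\<close>

definition num_op :: "complex \<Rightarrow> ('a::chilbert_space \<Rightarrow> 'a) \<Rightarrow> 'a \<Rightarrow> 'a"
  where "num_op c T =
    (\<lambda>x. ((\<lambda>y. (T ^^ 2) y - y) ^^ 2) x + cnj c *\<^sub>C ((\<lambda>y. (T ^^ 2) y + y) ^^ 2) x)"

definition den_op :: "complex \<Rightarrow> ('a::chilbert_space \<Rightarrow> 'a) \<Rightarrow> 'a \<Rightarrow> 'a"
  where "den_op c T =
    (\<lambda>x. ((\<lambda>y. (T ^^ 2) y + y) ^^ 2) x + c *\<^sub>C ((\<lambda>y. (T ^^ 2) y - y) ^^ 2) x)"

definition num_poly :: "complex \<Rightarrow> complex poly"
  where "num_poly c = ([:0, 1:] ^ 2 - 1) ^ 2 + smult (cnj c) (([:0, 1:] ^ 2 + 1) ^ 2)"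

definition den_poly :: "complex \<Rightarrow> complex poly"
  where "den_poly c = ([:0, 1:] ^ 2 + 1) ^ 2 + smult c (([:0, 1:] ^ 2 - 1) ^ 2)"

text \<open>
  For \<open>|c| = 1\<close> the common polynomial factor is divided out before \<open>T\<close> is substituted (the
  operator \<^term>\<open>den_op c T\<close> itself need not be invertible then). For \<open>|c| < 1\<close> numerator and
  denominator are taken literally.
\<close>

definition quot_num :: "complex \<Rightarrow> ('a::chilbert_space \<Rightarrow> 'a) \<Rightarrow> 'a \<Rightarrow> 'a"
  where "quot_num c T =
    (if norm c = 1 then op_poly (num_poly c div gcd (num_poly c) (den_poly c)) T
     else num_op c T)"

definition quot_den :: "complex \<Rightarrow> ('a::chilbert_space \<Rightarrow> 'a) \<Rightarrow> 'a \<Rightarrow> 'a"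
  where "quot_den c T =
    (if norm c = 1 then op_poly (den_poly c div gcd (num_poly c) (den_poly c)) T
     else den_op c T)"

text \<open>
  The existence of the inverse in the quotient is part of the assertion. The argument of type
  \<^typ>\<open>'a itself\<close> names the Hilbert space on which the operators act.
\<close>

definition admissible :: "'a::chilbert_space itself \<Rightarrow> complex \<Rightarrow> bool"
  where "admissible (_ :: 'a itself) c \<longleftrightarrow>
    (\<forall>T :: 'a \<Rightarrow> 'a. bounded_clinear T \<longrightarrow> numerical_range T \<subseteq> sector (pi / 4) \<longrightarrow>
      op_invertible (quot_den c T) \<and> onorm (quot_num c T \<circ> inv (quot_den c T)) \<le> sqrt 2)"

section \<open>The arcs\<close>

definition s_par :: "real \<Rightarrow> real"
  where "s_par t = (1 - 4 * t ^ 4) / (2 * t ^ 2)"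

definition zeta_par :: "real \<Rightarrow> complex"
  where "zeta_par t =
    (4 - complex_of_real (s_par t) ^ 2 + 4 * \<i> * complex_of_real (s_par t)) /
    (4 + complex_of_real (s_par t) ^ 2)"

definition covered_arcs :: "complex set"
  where "covered_arcs = zeta_par ` {1/10..18/25} \<union> (\<lambda>t. cnj (zeta_par t)) ` {1/10..18/25}"

text \<open>The open arc of the unit circle of angular length \<open>L\<close> centred at the unit vector \<open>z\<close>.\<close>

definition circle_arc :: "complex \<Rightarrow> real \<Rightarrow> complex set"
  where "circle_arc z L = {z * cis \<phi> | \<phi>. \<bar>\<phi>\<bar> < L / 2}"

end

theory Submission
  imports Defs
begin

text \<open>
  Write \<open>E = T\<^sup>4 + I\<close> and \<open>S = T\<^sup>2\<close>. Then \<open>(T\<^sup>2 + I)\<^sup>2 = E + 2 S\<close> and \<open>(T\<^sup>2 - I)\<^sup>2 = E - 2 S\<close>, and for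
  the denominator \<open>D\<close> and the numerator \<open>N\<close> the defect \<open>2 \<parallel>D y\<parallel>\<^sup>2 - \<parallel>N y\<parallel>\<^sup>2\<close> is the positive multiple
  \<open>2 (1 - |c|\<^sup>2)\<close> of
  \<open>a \<parallel>E y\<parallel>\<^sup>2 + d \<parallel>S y\<parallel>\<^sup>2 + 2 b Im \<langle>E y, S y\<rangle> + 6 Re \<langle>E y, S y\<rangle>\<close>,
  where \<open>(a, b, d)\<close> runs through the hyperboloid \<open>a d - b\<^sup>2 = 1\<close>, \<open>a > 0\<close>, as \<open>c\<close> runs through the
  open unit disc (\<open>num_den_defect\<close>). So the norm bound is the nonnegativity of this form on the
  hyperboloid (\<open>plane_form_hyperboloid_nonneg\<close>).

  The hypothesis on \<open>W(T)\<close> says that the two Hermitian forms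
  \<open>(1 + \<sigma> \<i>) \<langle>T u, v\<rangle> + (1 - \<sigma> \<i>) \<langle>u, T v\<rangle>\<close>, \<open>\<sigma> = 1\<close> and \<open>\<sigma> = - 1\<close>, are positive. The form above is shown to be
  \<open>a \<parallel>q(T) y\<parallel>\<^sup>2\<close> with a palindromic quartic \<open>q\<close>, plus nonnegative combinations of the values of these two
  Hermitian forms on \<open>y + T\<^sup>2 y\<close>, \<open>T y + T\<^sup>3 y\<close>, \<open>T\<^sup>2 y\<close>, \<open>T y\<close> (\<open>plane_form_certificate\<close>). The
  coefficient matrix of each combination is four by four and splits into two-by-two blocks, so that
  its positivity is one scalar inequality, with a free parameter \<open>e > 0\<close>
  (\<open>plane_form_criterion\<close>). On the light cone \<open>a d = b\<^sup>2\<close> a suitable \<open>e\<close> gives the bound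
  \<open>\<parallel>E y - \<i> s S y\<parallel>\<^sup>2 + 4 sqrt (4 + s\<^sup>2) Re \<langle>E y, S y\<rangle> \<ge> 0\<close> for every real \<open>s\<close>, which dominates all points of
  the hyperboloid with \<open>4 a\<^sup>2 + b\<^sup>2 \<ge> 9/4\<close>; the remaining points are reached by three further choices
  of \<open>e\<close>.

  The denominator is a multiple of \<open>(T\<^sup>2 - u) (T\<^sup>2 - v)\<close> with \<open>u\<close> and \<open>v\<close> in the open left half-plane,
  so it is a product of operators \<open>T - z\<close> with \<open>z\<close> outside the sector; these are invertible because
  they are coercive after a rotation. On the unit circle the numerator is \<open>cnj c\<close> times the
  denominator. Thus every \<open>c\<close> in the closed unit disc is admissible (\<open>admissible_closed_disc\<close>). The
  arcs are found from \<open>zeta_par t = cis (2 arctan (s_par t / 2))\<close>.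
\<close>

section \<open>Calculus in complex Hilbert spaces\<close>

lemma cinner_add_right: "cinner x (y + z) = cinner x y + cinner x z"
  for x :: "'a::chilbert_space"
  by (metis cinner_add_left cinner_commute complex_cnj_add)

lemma cinner_scaleC_right: "cinner x (a *\<^sub>C y) = cnj a * cinner x y"
  for x :: "'a::chilbert_space"
  by (metis cinner_scaleC_left cinner_commute complex_cnj_mult)

lemma minus_eq_scaleC: "- x = (- 1) *\<^sub>C x" for x :: "'a::chilbert_space"
  using scaleC_of_real[of "-1" x] by simp

lemma diff_eq_scaleC: "x - y = x + (- 1) *\<^sub>C y" for x :: "'a::chilbert_space"
  using minus_eq_scaleC[of y] by simp

lemma scaleC_one: "1 *\<^sub>C x = x" for x :: "'a::chilbert_space"
  using scaleC_of_real[of 1 x] by simp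

lemma scaleC_zero: "0 *\<^sub>C x = 0" for x :: "'a::chilbert_space"
  using scaleC_of_real[of 0 x] by simp

lemma cinner_self: "cinner x x = of_real ((norm x)\<^sup>2)" for x :: "'a::chilbert_space"
proof -
  have "Im (cinner x x) = 0"
    by (metis cinner_commute complex_cnj_cancel_iff complex_eq_iff cnj.simps(2) equal_neg_zero)
  then show ?thesis
    by (simp add: complex_eq_iff inner_eq_Re_cinner[symmetric] power2_norm_eq_inner)
qed

lemma norm_scaleC: "norm (a *\<^sub>C x) = norm a * norm x" for x :: "'a::chilbert_space"
proof -
  have "complex_of_real ((norm (a *\<^sub>C x))\<^sup>2) = (a * cnj a) * of_real ((norm x)\<^sup>2)"
    by (simp only: cinner_self[symmetric] cinner_scaleC_left cinner_scaleC_right ac_simps)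
  also have "\<dots> = of_real ((norm a * norm x)\<^sup>2)"
    by (simp add: complex_norm_square[symmetric] power_mult_distrib del: of_real_power flip: of_real_mult)
  finally have "(norm (a *\<^sub>C x))\<^sup>2 = (norm a * norm x)\<^sup>2"
    by (simp only: of_real_eq_iff)
  then show ?thesis
    by (simp add: power2_eq_iff_nonneg)
qed

lemma scaleC_minus_left: "(- a) *\<^sub>C x = - (a *\<^sub>C x)" for x :: "'a::chilbert_space"
  using scaleC_scaleC[of "- 1" a x] minus_eq_scaleC[of "a *\<^sub>C x"] by simp

lemma scaleC_diff_right: "a *\<^sub>C (x - y) = a *\<^sub>C x - a *\<^sub>C y" for x :: "'a::chilbert_space"
  using scaleC_add_right[of a "x - y" y] by simp

lemma scaleC_diff_left: "(a - b) *\<^sub>C x = a *\<^sub>C x - b *\<^sub>C x" for x :: "'a::chilbert_space"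
  using scaleC_add_left[of "a - b" b x] by simp

lemma scaleC_double: "(2 * a) *\<^sub>C x = a *\<^sub>C x + a *\<^sub>C x" for x :: "'a::chilbert_space"
  by (simp add: scaleC_add_left[symmetric])

lemma cinner_diff_left: "cinner (x - y) z = cinner x z - cinner y z" for x :: "'a::chilbert_space"
  using cinner_add_left[of "x - y" y z] by simp

lemma norm_combination:
  "(norm (\<alpha> *\<^sub>C x + \<beta> *\<^sub>C y))\<^sup>2
    = (norm \<alpha>)\<^sup>2 * (norm x)\<^sup>2 + (norm \<beta>)\<^sup>2 * (norm y)\<^sup>2 + 2 * Re (\<alpha> * cnj \<beta> * cinner x y)"
  for x y :: "'a::chilbert_space"
proof -
  have "complex_of_real ((norm (\<alpha> *\<^sub>C x + \<beta> *\<^sub>C y))\<^sup>2)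
    = (\<alpha> * cnj \<alpha>) * cinner x x + (\<beta> * cnj \<beta>) * cinner y y
      + (\<alpha> * cnj \<beta> * cinner x y + cnj (\<alpha> * cnj \<beta> * cinner x y))"
    by (simp add: cinner_self[symmetric] cinner_add_left cinner_add_right cinner_scaleC_left
      cinner_scaleC_right cinner_commute[of y x] algebra_simps del: of_real_power)
  also have "\<dots> = of_real ((norm \<alpha>)\<^sup>2 * (norm x)\<^sup>2 + (norm \<beta>)\<^sup>2 * (norm y)\<^sup>2
      + 2 * Re (\<alpha> * cnj \<beta> * cinner x y))"
    by (simp only: cinner_self complex_norm_square[symmetric] complex_add_cnj of_real_add of_real_mult of_real_power)
  finally show ?thesis by (simp only: of_real_eq_iff)
qed

lemma bounded_clinear_add: "bounded_clinear T \<Longrightarrow> T (x + y) = T x + T y"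
  by (simp add: bounded_clinear_def linear_add bounded_linear.linear)

lemma bounded_clinear_scaleC: "bounded_clinear T \<Longrightarrow> T (a *\<^sub>C x) = a *\<^sub>C T x"
  by (simp add: bounded_clinear_def)

lemma bounded_clinear_diff: "bounded_clinear T \<Longrightarrow> T (x - y) = T x - T y"
  by (simp add: bounded_clinear_def linear_diff bounded_linear.linear)

section \<open>Positive Hermitian forms\<close>

locale positive_form =
  fixes \<Phi> :: "'a::chilbert_space \<Rightarrow> 'a \<Rightarrow> complex"
  assumes add_left: "\<Phi> (x + y) z = \<Phi> x z + \<Phi> y z"
    and scale_left: "\<Phi> (a *\<^sub>C x) z = a * \<Phi> x z"
    and hermitian: "\<Phi> x y = cnj (\<Phi> y x)"
    and nonneg: "0 \<le> Re (\<Phi> x x)"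
begin

lemma add_right: "\<Phi> x (y + z) = \<Phi> x y + \<Phi> x z"
  by (metis add_left hermitian complex_cnj_add)

lemma scale_right: "\<Phi> x (a *\<^sub>C y) = cnj a * \<Phi> x y"
  by (metis scale_left hermitian complex_cnj_mult)

lemmas expand = add_left scale_left add_right scale_right

text \<open>The form with coefficient matrix \<open>((p, w), (cnj w, p))\<close>, which is positive when \<open>|w| \<le> p\<close>.\<close>
definition pair_form :: "real \<Rightarrow> complex \<Rightarrow> 'a \<Rightarrow> 'a \<Rightarrow> complex"
  where "pair_form p w u v = of_real p * (\<Phi> u u + \<Phi> v v) + w * \<Phi> u v + cnj w * \<Phi> v u"

lemma pair_form_nonneg:
  assumes "norm w \<le> p"
  shows "0 \<le> Re (pair_form p w u v)"
proof (cases "p = 0")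
  case True
  then show ?thesis using assms by (simp add: pair_form_def)
next
  case False
  with assms have p: "0 < p" using norm_ge_zero[of w] by linarith
  have sq: "(norm w)\<^sup>2 \<le> p\<^sup>2" using assms by (intro power_mono) auto
  let ?x = "of_real p *\<^sub>C u + cnj w *\<^sub>C v"
  have "of_real p * pair_form p w u v = \<Phi> ?x ?x + (of_real (p\<^sup>2) - w * cnj w) * \<Phi> v v"
    by (simp add: pair_form_def expand algebra_simps power2_eq_square)
  also have "of_real (p\<^sup>2) - w * cnj w = of_real (p\<^sup>2 - (norm w)\<^sup>2)"
    by (simp add: complex_norm_square[symmetric])
  finally have "p * Re (pair_form p w u v) = Re (\<Phi> ?x ?x) + (p\<^sup>2 - (norm w)\<^sup>2) * Re (\<Phi> v v)"
    by (metis Re_complex_of_real plus_complex.sel(1) times_complex.sel(1) Im_complex_of_real mult_zero_left diff_zero)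
  also have "\<dots> \<ge> 0" using nonneg sq by (simp add: add_nonneg_nonneg)
  finally show ?thesis using p by (simp add: zero_le_mult_iff)
qed

text \<open>
  In the order \<open>f0, f3, f2, f1\<close> the coefficient matrix is
  \<open>((A, \<theta> J), (cnj \<theta> J\<^sup>T, e A\<^sup>T))\<close> with \<open>A = ((p, w), (cnj w, p))\<close> and \<open>J = ((0, 1), (- 1, 0))\<close>. Since
  \<open>A (J A\<^sup>T J\<^sup>T) = det A\<close> for any two-by-two matrix, the Schur complement of \<open>A\<close> is the multiple
  \<open>e - |\<theta>|\<^sup>2 / det A\<close> of \<open>A\<^sup>T\<close>, and positivity of the whole matrix is decided by this scalar.
\<close>
lemma twisted_block_nonneg:
  assumes w: "norm w \<le> p" and e: "0 \<le> e" and \<theta>: "(norm \<theta>)\<^sup>2 \<le> e * (p\<^sup>2 - (norm w)\<^sup>2)"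
  shows "0 \<le> Re (pair_form p w f0 f3 + of_real e * pair_form p (cnj w) f2 f1
     + \<theta> * (\<Phi> f0 f1 - \<Phi> f3 f2) + cnj \<theta> * (\<Phi> f1 f0 - \<Phi> f2 f3))"
proof (cases "p\<^sup>2 = (norm w)\<^sup>2")
  case True
  then have "\<theta> = 0" using \<theta> by simp
  moreover have "0 \<le> Re (pair_form p w f0 f3)" "0 \<le> Re (pair_form p (cnj w) f2 f1)"
    using w by (auto intro!: pair_form_nonneg)
  ultimately show ?thesis using e by simp
next
  case False
  define \<Delta> where "\<Delta> = p\<^sup>2 - (norm w)\<^sup>2"
  have "(norm w)\<^sup>2 \<le> p\<^sup>2" using w by (intro power_mono) auto
  with False have \<Delta>: "0 < \<Delta>" by (simp add: \<Delta>_def)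
  define l where "l = cnj \<theta> / of_real \<Delta>"
  have \<Delta>c: "of_real \<Delta> = of_real p * of_real p - w * cnj w"
    unfolding \<Delta>_def by (simp add: complex_norm_square[symmetric] power2_eq_square)
  have th: "\<theta> = cnj l * (of_real p * of_real p - w * cnj w)"
    "cnj \<theta> = l * (of_real p * of_real p - w * cnj w)"
    unfolding \<Delta>c[symmetric] using \<Delta> by (simp_all add: l_def)
  \<comment> \<open>Completing the square: \<open>?u0, ?u3\<close> are \<open>f0, f3\<close> corrected by the conjugate of \<open>\<theta> J A\<^sup>T / det A\<close> applied
    to \<open>f2, f1\<close>.\<close>
  let ?u0 = "f0 + (l * cnj w) *\<^sub>C f2 + (l * of_real p) *\<^sub>C f1"
  let ?u3 = "f3 + (- l * of_real p) *\<^sub>C f2 + (- l * w) *\<^sub>C f1"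
  define \<epsilon> where "\<epsilon> = e - (norm \<theta>)\<^sup>2 / \<Delta>"
  have "0 \<le> \<epsilon>" using \<theta> \<Delta> by (simp add: \<epsilon>_def \<Delta>_def divide_le_eq mult.commute)
  have "of_real ((norm \<theta>)\<^sup>2 / \<Delta>) = l * cnj l * of_real \<Delta>"
    using \<Delta> by (simp add: l_def complex_norm_square mult.commute del: of_real_power)
  then have e\<epsilon>: "of_real e = of_real \<epsilon> + l * cnj l * (of_real p * of_real p - w * cnj w)"
    unfolding \<Delta>c[symmetric] by (simp add: \<epsilon>_def)
  have "pair_form p w f0 f3 + of_real e * pair_form p (cnj w) f2 f1
     + \<theta> * (\<Phi> f0 f1 - \<Phi> f3 f2) + cnj \<theta> * (\<Phi> f1 f0 - \<Phi> f2 f3)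
    = pair_form p w ?u0 ?u3 + of_real \<epsilon> * pair_form p (cnj w) f2 f1"
    unfolding th e\<epsilon> by (simp add: pair_form_def expand) algebra
  moreover have "0 \<le> Re (pair_form p w ?u0 ?u3)" "0 \<le> Re (pair_form p (cnj w) f2 f1)"
    using w by (auto intro!: pair_form_nonneg)
  ultimately show ?thesis using \<open>0 \<le> \<epsilon>\<close> by simp
qed

end

section \<open>Operators with numerical range in the sector\<close>

lemma sector_pi_4D:
  "z \<in> sector (pi / 4) \<Longrightarrow> \<bar>Im z\<bar> \<le> Re z"
proof -
  assume "z \<in> sector (pi / 4)"
  then obtain r \<theta> where z: "z = of_real r * cis \<theta>" and r: "0 \<le> r" and \<theta>: "\<bar>\<theta>\<bar> \<le> pi / 4"
    by (auto simp: sector_def)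
  have c: "cos (pi / 4) \<le> cos \<bar>\<theta>\<bar>" using \<theta> by (intro cos_monotone_0_pi_le) auto
  have s: "sin \<bar>\<theta>\<bar> \<le> sin (pi / 4)" using \<theta> pi_gt_zero by (intro sin_monotone_2pi_le) auto
  have "\<bar>sin \<theta>\<bar> = sin \<bar>\<theta>\<bar>"
  proof -
    have "0 \<le> sin \<bar>\<theta>\<bar>" using \<theta> by (intro sin_ge_zero) auto
    then show ?thesis by (cases "0 \<le> \<theta>") (auto simp: abs_if split: if_splits)
  qed
  then have "\<bar>sin \<theta>\<bar> \<le> cos \<theta>" using c s by (simp add: sin_45 cos_45)
  then show ?thesis using r by (simp add: z abs_mult mult_left_mono)
qed

definition sectorial :: "('a::chilbert_space \<Rightarrow> 'a) \<Rightarrow> bool"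
  where "sectorial T \<longleftrightarrow> bounded_clinear T \<and> numerical_range T \<subseteq> sector (pi / 4)"

text \<open>By homogeneity the condition on unit vectors passes to all vectors.\<close>
lemma sectorial_form:
  assumes "sectorial T"
  shows "\<bar>Im (cinner (T x) x)\<bar> \<le> Re (cinner (T x) x)"
proof (cases "x = 0")
  case True
  have "cinner (T x) 0 = 0" using cinner_scaleC_right[of "T x" 0 0] by (simp add: scaleC_zero)
  then show ?thesis using True by simp
next
  case False
  define u where "u = of_real (1 / norm x) *\<^sub>C x"
  have x: "x = of_real (norm x) *\<^sub>C u"
    using False by (simp add: u_def scaleC_of_real scaleC_scaleC scaleC_one flip: of_real_mult)
  have "norm u = 1" using False by (simp add: u_def norm_scaleC norm_divide)
  then have "cinner (T u) u \<in> sector (pi / 4)"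
    using assms by (auto simp: sectorial_def numerical_range_def)
  then have *: "\<bar>Im (cinner (T u) u)\<bar> \<le> Re (cinner (T u) u)" by (rule sector_pi_4D)
  have "cinner (T x) x = of_real ((norm x)\<^sup>2) * cinner (T u) u"
    using assms by (subst x, subst (2) x)
      (simp add: sectorial_def bounded_clinear_scaleC cinner_scaleC_left cinner_scaleC_right
        power2_eq_square)
  then show ?thesis using * by (simp add: abs_mult mult_left_mono del: of_real_power)
qed

text \<open>
  Twice the Hermitian part of \<open>(1 + \<sigma> \<i>) T\<close>. For \<open>\<sigma> = 1\<close> and \<open>\<sigma> = - 1\<close> its positivity says that \<open>W(T)\<close>
  lies in one of the two half-planes whose intersection is the sector.
\<close>
definition side_form :: "real \<Rightarrow> ('a::chilbert_space \<Rightarrow> 'a) \<Rightarrow> 'a \<Rightarrow> 'a \<Rightarrow> complex"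
  where "side_form \<sigma> T u v = (1 + \<sigma> * \<i>) * cinner (T u) v + (1 - \<sigma> * \<i>) * cinner u (T v)"

lemma positive_form_side_form:
  assumes T: "sectorial T" and \<sigma>: "\<bar>\<sigma>\<bar> = 1"
  shows "positive_form (side_form \<sigma> T)"
proof
  have lin: "bounded_clinear T" using T by (simp add: sectorial_def)
  fix x y z :: 'a and a :: complex
  show "side_form \<sigma> T (x + y) z = side_form \<sigma> T x z + side_form \<sigma> T y z"
    by (simp add: side_form_def bounded_clinear_add[OF lin] cinner_add_left algebra_simps)
  show "side_form \<sigma> T (a *\<^sub>C x) z = a * side_form \<sigma> T x z"
    by (simp add: side_form_def bounded_clinear_scaleC[OF lin] cinner_scaleC_left algebra_simps)
  show "side_form \<sigma> T x y = cnj (side_form \<sigma> T y x)"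
    by (simp add: side_form_def cinner_commute[of "T x" y] cinner_commute[of x "T y"])
  have "cinner x (T x) = cnj (cinner (T x) x)" by (rule cinner_commute)
  then have "Re (side_form \<sigma> T x x) = 2 * (Re (cinner (T x) x) - \<sigma> * Im (cinner (T x) x))"
    by (simp add: side_form_def)
  moreover have "\<sigma> * Im (cinner (T x) x) \<le> \<bar>Im (cinner (T x) x)\<bar>"
    using abs_ge_self[of "\<sigma> * Im (cinner (T x) x)"] \<sigma> by (simp add: abs_mult)
  moreover have "\<dots> \<le> Re (cinner (T x) x)" by (rule sectorial_form[OF T])
  ultimately show "0 \<le> Re (side_form \<sigma> T x x)" by simp
qed

section \<open>A sum-of-squares identity\<close>

definition plane_form :: "real \<Rightarrow> real \<Rightarrow> real \<Rightarrow> 'a::chilbert_space \<Rightarrow> 'a \<Rightarrow> real"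
  where "plane_form a b c E S = a * (norm E)\<^sup>2 + c * (norm S)\<^sup>2
     + 2 * b * Im (cinner E S) + 6 * Re (cinner E S)"

lemma of_real_plane_form:
  "complex_of_real (plane_form a b c E S) = of_real a * cinner E E + of_real c * cinner S S
     + (3 - b * \<i>) * cinner E S + (3 + b * \<i>) * cinner S E"
  by (simp add: plane_form_def cinner_self cinner_commute[of S E] complex_eq_iff algebra_simps
       del: of_real_power)

text \<open>
  The identity behind the theorem. The forms \<open>side_form 1\<close> and \<open>side_form (- 1)\<close> enter with
  coefficient matrices that are exchanged by reversing the polynomials, \<open>y + T\<^sup>2 y\<close> against
  \<open>T y + T\<^sup>3 y\<close> and \<open>T\<^sup>2 y\<close> against \<open>T y\<close>; this reflects the symmetry \<open>z \<mapsto> 1 / z\<close> of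
  \<open>(z\<^sup>4 + 1) / z\<^sup>2\<close>, which exchanges the two sides of the sector. The parameter \<open>b\<close> enters only through
  the real part of \<open>\<theta>\<close>. The equations for \<open>r\<close> and \<open>c\<close> make the coefficients of the two sides agree.
\<close>
lemma plane_form_certificate:
  fixes T :: "'a::chilbert_space \<Rightarrow> 'a" and a b e \<beta> :: real and y :: 'a
  assumes T: "sectorial T" and a: "0 \<le> a" and e: "0 < e" and \<beta>: "0 \<le> \<beta>"
    and r: "r = (3 - a * (e + 2)) / 2 - a * \<beta>\<^sup>2 / 4"
    and c: "c = a * (e\<^sup>2 - 4) + 12 + 4 * e * r"
    and cond: "(3 - a * (e + 2))\<^sup>2 + b\<^sup>2 \<le> e * (a\<^sup>2 * \<beta>\<^sup>2 - 2 * r\<^sup>2)"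
  shows "0 \<le> plane_form a b c (T (T (T (T y))) + y) (T (T y))"
proof -
  have lin: "bounded_clinear T" using T by (simp add: sectorial_def)
  interpret P: positive_form "side_form 1 T" by (rule positive_form_side_form[OF T]) simp
  interpret M: positive_form "side_form (- 1) T" by (rule positive_form_side_form[OF T]) simp
  \<comment> \<open>Halving the parameters turns the identity into one with integer coefficients; the \<open>3\<close> from
    \<open>6 Re \<langle>E, S\<rangle>\<close> is then replaced by its value in terms of \<open>r\<close>.\<close>
  define \<alpha> \<gamma> \<rho> \<kappa> where "\<alpha> = a / 2" and "\<gamma> = \<beta> / 2" and "\<rho> = r / 2" and "\<kappa> = (3 - a * (e + 2)) / 2"
  have params: "a = 2 * \<alpha>" "\<beta> = 2 * \<gamma>" "r = 2 * \<rho>" "\<kappa> = 2 * \<rho> + 2 * \<alpha> * \<gamma>\<^sup>2"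
    "3 = 4 * \<rho> + 2 * \<alpha> * (e + 2) + 4 * \<alpha> * \<gamma>\<^sup>2"
    unfolding r \<alpha>_def \<gamma>_def \<rho>_def \<kappa>_def by (simp_all add: power_divide field_simps)
  define p where "p = 2 * \<alpha> * \<gamma>"
  define w where "w = (1 - \<i>) * of_real \<rho>"
  define \<theta> where "\<theta> = of_real (b / 2) + \<i> * of_real \<kappa>"
  define v1 v2 v3 v4 where v: "v1 = T y" "v2 = T v1" "v3 = T v2" "v4 = T v3"
  define f0 f3 where f: "f0 = y + v2" "f3 = v1 + v3"
  have T_f: "T f0 = f3" "T f3 = v2 + v4" by (simp_all add: f v bounded_clinear_add[OF lin])
  define q where "q = y + of_real (- \<beta>) *\<^sub>C v1 + of_real (e + 2) *\<^sub>C v2 + of_real (- \<beta>) *\<^sub>C v3 + v4"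
  have nw: "(norm w)\<^sup>2 = r\<^sup>2 / 2"
    by (simp add: w_def norm_mult power_mult_distrib cmod_power2 power_divide \<rho>_def)
  have n\<theta>: "(norm \<theta>)\<^sup>2 = (b\<^sup>2 + (3 - a * (e + 2))\<^sup>2) / 4"
    by (simp add: \<theta>_def cmod_power2 power_divide add_divide_distrib \<kappa>_def)
  have np: "p\<^sup>2 = a\<^sup>2 * \<beta>\<^sup>2 / 4" by (simp add: p_def \<alpha>_def \<gamma>_def power_mult_distrib power_divide)
  have "0 \<le> e * (a\<^sup>2 * \<beta>\<^sup>2 - 2 * r\<^sup>2)"
    by (rule order_trans[OF _ cond]) simp
  then have "2 * r\<^sup>2 \<le> a\<^sup>2 * \<beta>\<^sup>2" using e by (simp add: zero_le_mult_iff)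
  then have "(norm w)\<^sup>2 \<le> p\<^sup>2" by (simp add: nw np)
  then have wp: "norm w \<le> p" by (rule power2_le_imp_le) (use a \<beta> in \<open>simp add: p_def \<alpha>_def \<gamma>_def\<close>)
  have "(norm \<theta>)\<^sup>2 \<le> e * (p\<^sup>2 - (norm w)\<^sup>2)"
    unfolding nw n\<theta> np using cond by (simp add: algebra_simps)
  note block = P.twisted_block_nonneg[OF wp less_imp_le[OF e] this, of f0 f3 v2 v1]
    M.twisted_block_nonneg[OF wp less_imp_le[OF e] this, of f3 f0 v1 v2]
  \<comment> \<open>In the sums over the two sides all occurrences of \<open>\<i>\<close> cancel, except the one in \<open>\<theta>\<close>. What
    is left is an identity between polynomials in the parameters and the inner products of the \<open>T\<^sup>k y\<close>.\<close>
  have A: "P.pair_form p w f0 f3 + M.pair_form p w f3 f0 = 8 * \<rho> * cinner f3 f3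
      + 2 * p * (cinner f3 f0 + cinner f0 f3 + cinner (v2 + v4) f3 + cinner f3 (v2 + v4))"
    unfolding P.pair_form_def M.pair_form_def side_form_def w_def
    by (simp add: T_f) (simp add: algebra_simps)
  have D: "P.pair_form p (cnj w) v2 v1 + M.pair_form p (cnj w) v1 v2 = 8 * \<rho> * cinner v2 v2
      + 2 * p * (cinner v2 v1 + cinner v1 v2 + cinner v3 v2 + cinner v2 v3)"
    unfolding P.pair_form_def M.pair_form_def side_form_def w_def
    by (simp add: v[symmetric]) (simp add: algebra_simps)
  have B: "\<theta> * (side_form 1 T f0 v1 - side_form 1 T f3 v2)
      + cnj \<theta> * (side_form 1 T v1 f0 - side_form 1 T v2 f3)
      + (\<theta> * (side_form (- 1) T f3 v2 - side_form (- 1) T f0 v1)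
      + cnj \<theta> * (side_form (- 1) T v2 f3 - side_form (- 1) T v1 f0))
    = (\<i> * of_real b - 2 * \<kappa>) * (cinner f3 v1 - cinner f0 v2 - cinner (v2 + v4) v2 + cinner f3 v3)
    + (\<i> * of_real b + 2 * \<kappa>) * (cinner v2 f0 - cinner v1 f3 - cinner v3 f3 + cinner v2 (v2 + v4))"
    unfolding side_form_def \<theta>_def
    by (simp add: T_f v[symmetric]) (simp add: algebra_simps)
  define \<eta> where "\<eta> = \<i> * of_real b"
  have three: "(3 - b * \<i>) = 4 * \<rho> + 2 * \<alpha> * (e + 2) + 4 * \<alpha> * \<gamma>\<^sup>2 - \<eta>"
    "(3 + b * \<i>) = 4 * \<rho> + 2 * \<alpha> * (e + 2) + 4 * \<alpha> * \<gamma>\<^sup>2 + \<eta>"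
    using arg_cong[OF params(5), of complex_of_real] by (simp_all add: \<eta>_def)
  have c': "c = 2 * \<alpha> * (e\<^sup>2 - 4) + 4 * (4 * \<rho> + 2 * \<alpha> * (e + 2) + 4 * \<alpha> * \<gamma>\<^sup>2) + 8 * e * \<rho>"
    using c params by simp
  have "complex_of_real (plane_form a b c (v4 + y) v2) = of_real a * cinner q q
    + (P.pair_form p w f0 f3 + M.pair_form p w f3 f0)
    + of_real e * (P.pair_form p (cnj w) v2 v1 + M.pair_form p (cnj w) v1 v2)
    + (\<theta> * (side_form 1 T f0 v1 - side_form 1 T f3 v2)
      + cnj \<theta> * (side_form 1 T v1 f0 - side_form 1 T v2 f3)
      + (\<theta> * (side_form (- 1) T f3 v2 - side_form (- 1) T f0 v1)
      + cnj \<theta> * (side_form (- 1) T v2 f3 - side_form (- 1) T v1 f0)))"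
    unfolding A D B
    unfolding of_real_plane_form three q_def f p_def \<eta>_def[symmetric]
      cinner_add_left cinner_add_right cinner_scaleC_left cinner_scaleC_right
      complex_cnj_complex_of_real
    unfolding c' params(1,2,4) of_real_add of_real_mult of_real_diff of_real_power of_real_minus of_real_numeral
    by algebra
  also have "\<dots> = of_real (a * (norm q)\<^sup>2)
    + (P.pair_form p w f0 f3 + of_real e * P.pair_form p (cnj w) v2 v1
      + \<theta> * (side_form 1 T f0 v1 - side_form 1 T f3 v2)
      + cnj \<theta> * (side_form 1 T v1 f0 - side_form 1 T v2 f3))
    + (M.pair_form p w f3 f0 + of_real e * M.pair_form p (cnj w) v1 v2
      + \<theta> * (side_form (- 1) T f3 v2 - side_form (- 1) T f0 v1)
      + cnj \<theta> * (side_form (- 1) T v2 f3 - side_form (- 1) T v1 f0))" (is "_ = _ + ?P + ?M")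
    unfolding of_real_mult cinner_self by algebra
  finally have "Re (complex_of_real (plane_form a b c (v4 + y) v2))
      = Re (complex_of_real (a * (norm q)\<^sup>2) + ?P + ?M)" by (rule arg_cong)
  then have "plane_form a b c (v4 + y) v2 = a * (norm q)\<^sup>2 + Re ?P + Re ?M"
    by (simp only: Re_complex_of_real plus_complex.sel)
  moreover have "0 \<le> a * (norm q)\<^sup>2" using a by simp
  ultimately have "0 \<le> plane_form a b c (v4 + y) v2"
    using block by (simp only: add_nonneg_nonneg)
  then show ?thesis by (simp only: v)
qed

section \<open>Positivity on the hyperboloid\<close>

text \<open>
  Given \<open>e\<close>, the relation between \<open>c\<close> and \<open>r\<close> determines \<open>r\<close>, and then the definition of \<open>r\<close>
  determines \<open>a e \<beta>\<^sup>2\<close>. The hypothesis is the positivity condition of the certificate with both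
  eliminated; it implies in particular that \<open>\<beta>\<close> is real.
\<close>
lemma plane_form_criterion:
  assumes T: "sectorial T" and a: "0 < a" and e: "0 < e"
    and cond: "(c - 12 - a * (e\<^sup>2 - 4))\<^sup>2 + 8 * e * ((3 - a * (e + 2))\<^sup>2 + b\<^sup>2)
      \<le> 8 * e * (a * (6 * (e + 2) - a * (e + 2)\<^sup>2 - c))"
  shows "0 \<le> plane_form a b c (T (T (T (T y))) + y) (T (T y))"
proof -
  define N where "N = 6 * (e + 2) - a * (e + 2)\<^sup>2 - c"
  define r where "r = (c - 12 - a * (e\<^sup>2 - 4)) / (4 * e)"
  define \<beta> where "\<beta> = sqrt (N / (a * e))"
  have "0 \<le> 8 * e * (a * N)"
    unfolding N_def by (rule order_trans[OF _ cond]) (use e in simp)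
  then have "0 \<le> N" using a e by (simp add: zero_le_mult_iff)
  then have \<beta>2: "a * e * \<beta>\<^sup>2 = N" and \<beta>: "0 \<le> \<beta>" using a e by (simp_all add: \<beta>_def)
  have c: "c = a * (e\<^sup>2 - 4) + 12 + 4 * e * r" using e by (simp add: r_def)
  have "e * r = e * ((3 - a * (e + 2)) / 2 - a * \<beta>\<^sup>2 / 4)"
    using \<beta>2 c unfolding N_def by (simp add: algebra_simps power2_eq_square)
  then have r: "r = (3 - a * (e + 2)) / 2 - a * \<beta>\<^sup>2 / 4" using e by simp
  have "(4 * e * r)\<^sup>2 + 8 * e * ((3 - a * (e + 2))\<^sup>2 + b\<^sup>2) \<le> 8 * e * (a * (a * e * \<beta>\<^sup>2))"
    using cond unfolding \<beta>2 N_def by (simp add: c)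
  then have "8 * e * ((3 - a * (e + 2))\<^sup>2 + b\<^sup>2) \<le> 8 * e * (e * (a\<^sup>2 * \<beta>\<^sup>2 - 2 * r\<^sup>2))"
    by (simp add: algebra_simps power2_eq_square)
  then have "(3 - a * (e + 2))\<^sup>2 + b\<^sup>2 \<le> e * (a\<^sup>2 * \<beta>\<^sup>2 - 2 * r\<^sup>2)"
    using e by (simp only: mult_le_cancel_left_pos[of "8 * e"] zero_less_mult_iff zero_less_numeral simp_thms)
  then show ?thesis using plane_form_certificate[OF T less_imp_le[OF a] e \<beta> r c] by blast
qed

text \<open>
  With \<open>s = a e\<close> the criterion depends on \<open>b\<close> only through \<open>g = 4 a\<^sup>2 + b\<^sup>2\<close>. For small \<open>a\<close> it forces
  \<open>s\<^sup>2\<close> to be near \<open>1 + g\<close>.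
\<close>
lemma plane_form_hyperboloid_criterion:
  assumes T: "sectorial T" and a: "0 < a" and h: "a * c = 1 + b\<^sup>2" and s: "0 < s"
    and cond: "(1 + (4 * a\<^sup>2 + b\<^sup>2) - 12 * a + 8 * s * a - s\<^sup>2)\<^sup>2 \<le> 32 * a * s * ((s - 1) * (2 - s))"
  shows "0 \<le> plane_form a b c (T (T (T (T y))) + y) (T (T y))"
proof (rule plane_form_criterion[OF T a])
  let ?e = "s / a"
  show "0 < ?e" using a s by simp
  define L where "L = (c - 12 - a * (?e\<^sup>2 - 4))\<^sup>2 + 8 * ?e * ((3 - a * (?e + 2))\<^sup>2 + b\<^sup>2)
      - 8 * ?e * (a * (6 * (?e + 2) - a * (?e + 2)\<^sup>2 - c))"
  have ae: "a * ?e = s" using a by simp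
  have "a\<^sup>2 * L = (a * c - 12 * a - (a * ?e)\<^sup>2 + 4 * a\<^sup>2)\<^sup>2 + 8 * (a * ?e) * a * ((3 - a * ?e - 2 * a)\<^sup>2 + b\<^sup>2)
     - 8 * (a * ?e) * a * (6 * (a * ?e + 2 * a) - (a * ?e + 2 * a)\<^sup>2 - a * c)"
    unfolding L_def by algebra
  also have "\<dots> = (1 + (4 * a\<^sup>2 + b\<^sup>2) - 12 * a + 8 * s * a - s\<^sup>2)\<^sup>2 - 32 * a * s * ((s - 1) * (2 - s))"
    unfolding ae h by algebra
  also have "\<dots> \<le> 0" using cond by simp
  finally have "L \<le> 0" using a by (simp add: mult_le_0_iff)
  then show "(c - 12 - a * (?e\<^sup>2 - 4))\<^sup>2 + 8 * ?e * ((3 - a * (?e + 2))\<^sup>2 + b\<^sup>2)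
      \<le> 8 * ?e * (a * (6 * (?e + 2) - a * (?e + 2)\<^sup>2 - c))"
    by (simp add: L_def)
qed

text \<open>
  Here \<open>(a, b, c)\<close> is a multiple of \<open>(1, s, s\<^sup>2)\<close>, so that the quadratic part of the form is a multiple
  of \<open>\<parallel>E + \<i> s S\<parallel>\<^sup>2\<close>. For any other \<open>e\<close> no multiple of \<open>(1, s, s\<^sup>2)\<close> satisfies the criterion: it is a
  quadratic inequality for the factor, whose discriminant is a negative multiple of
  \<open>(s\<^sup>2 - (e\<^sup>2 - 4))\<^sup>2\<close>. For this \<open>e\<close> it has one solution, with equality.
\<close>
lemma plane_form_light:
  assumes T: "sectorial T" and e_def: "e = sqrt (4 + s\<^sup>2)"
  shows "0 \<le> plane_form (3 / (2 * e)) (3 / (2 * e) * s) (3 / (2 * e) * s\<^sup>2)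
    (T (T (T (T y))) + y) (T (T y))"
proof (rule plane_form_criterion[OF T])
  have e: "0 < e" by (simp add: e_def add_pos_nonneg)
  have s: "s\<^sup>2 = e\<^sup>2 - 4" by (simp add: e_def)
  define a where "a = 3 / (2 * e)"
  have a: "a * e = 3 / 2" using e by (simp add: a_def)
  show "0 < e" "0 < 3 / (2 * e)" using e by auto
  have "(a * s\<^sup>2 - 12 - a * (e\<^sup>2 - 4))\<^sup>2 + 8 * e * ((3 - a * (e + 2))\<^sup>2 + (a * s)\<^sup>2)
      = 8 * e * (a * (6 * (e + 2) - a * (e + 2)\<^sup>2 - a * s\<^sup>2))"
    using a unfolding power_mult_distrib s by algebra
  then show "(3 / (2 * e) * s\<^sup>2 - 12 - 3 / (2 * e) * (e\<^sup>2 - 4))\<^sup>2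
      + 8 * e * ((3 - 3 / (2 * e) * (e + 2))\<^sup>2 + (3 / (2 * e) * s)\<^sup>2)
      \<le> 8 * e * (3 / (2 * e) * (6 * (e + 2) - 3 / (2 * e) * (e + 2)\<^sup>2 - 3 / (2 * e) * s\<^sup>2))"
    unfolding a_def by simp
qed

lemma plane_form_degenerate_nonneg:
  assumes "0 \<le> a" "0 \<le> k"
  shows "0 \<le> plane_form a (a * s) (a * s\<^sup>2 + k) E S - 6 * Re (cinner E S)" (is "0 \<le> ?L")
proof -
  have "complex_of_real ?L = of_real a * cinner (E + (\<i> * s) *\<^sub>C S) (E + (\<i> * s) *\<^sub>C S)
     + of_real k * cinner S S"
    unfolding of_real_diff of_real_plane_form
    by (simp add: cinner_add_left cinner_add_right cinner_scaleC_left cinner_scaleC_right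
         complex_eq_iff algebra_simps power2_eq_square cinner_commute[of S E])
  from arg_cong[OF this, of Re] show ?thesis
    using assms by (simp add: cinner_self del: of_real_power)
qed

text \<open>
  If \<open>4 a\<^sup>2 + b\<^sup>2 \<ge> 9/4\<close>, the point \<open>(a, b, c)\<close> exceeds the light-cone point with \<open>s = b / a\<close> by a positive
  semidefinite matrix. Otherwise \<open>a < 3/4\<close>, and the hyperboloid criterion applies with \<open>s = 3/2\<close>
  unless \<open>a\<close> is small; for small \<open>a\<close> the value \<open>s = sqrt (1 + g)\<close> annihilates the leading term of the
  left-hand side, and it works as long as it is not too close to \<open>1\<close>, where the right-hand side
  vanishes. Near \<open>b = 0\<close> the choice \<open>s = 1 + 2 a\<close> takes over; as \<open>a\<close> tends to \<open>0\<close> the coefficient \<open>2\<close>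
  is the only possible one on the axis \<open>b = 0\<close>.
\<close>
theorem plane_form_hyperboloid_nonneg:
  assumes T: "sectorial T" and a: "0 < a" and h: "a * c = 1 + b\<^sup>2"
  shows "0 \<le> plane_form a b c (T (T (T (T y))) + y) (T (T y))"
proof -
  define g where "g = 4 * a\<^sup>2 + b\<^sup>2"
  note crit = plane_form_hyperboloid_criterion[OF T a h, folded g_def]
  have g_ge: "4 * a\<^sup>2 \<le> g" by (simp add: g_def)
  consider (light) "9 / 4 \<le> g" | (mid) "g < 9 / 4" "25 / 192 \<le> a"
    | (near) "a < 25 / 192" "g \<le> 4 * a" | (far) "a < 25 / 192" "4 * a < g" "g < 9 / 4"
    by linarith
  then show ?thesis
  proof cases
    case light
    define s where "s = b / a"
    define e where "e = sqrt (4 + s\<^sup>2)"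
    define k where "k = 3 / (2 * e)"
    have e: "0 < e" by (simp add: e_def add_pos_nonneg)
    have "(a * e)\<^sup>2 = g"
      using a by (simp add: e_def s_def g_def power_mult_distrib power_divide algebra_simps)
    then have "(3 / 2)\<^sup>2 \<le> (a * e)\<^sup>2" using light by (simp add: power_divide)
    then have "3 / 2 \<le> a * e" by (rule power2_le_imp_le) (use a e in simp)
    then have ka: "0 \<le> a - k" using e by (simp add: k_def field_simps)
    have b: "b = a * s" using a by (simp add: s_def)
    have "a * c = a * (a * s\<^sup>2 + 1 / a)"
      unfolding h b using a by (simp add: distrib_left power2_eq_square)
    then have c: "c = a * s\<^sup>2 + 1 / a" using a by (simp only: mult_cancel_left) simp
    have split: "plane_form a b c E S = plane_form k (k * s) (k * s\<^sup>2) E S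
      + (plane_form (a - k) ((a - k) * s) ((a - k) * s\<^sup>2 + 1 / a) E S - 6 * Re (cinner E S))"
      for E S :: 'a unfolding plane_form_def b c by (simp add: algebra_simps)
    have "0 \<le> 1 / a" using a by simp
    then show ?thesis
      unfolding split
      by (intro add_nonneg_nonneg plane_form_degenerate_nonneg[OF ka]
          plane_form_light[OF T e_def, folded k_def])
  next
    case mid
    have "0 \<le> g" by (rule order_trans[OF _ g_ge]) simp
    \<comment> \<open>For \<open>s = 3/2\<close> the criterion reads \<open>(g - 5/4)\<^sup>2 \<le> 12 a\<close>, and \<open>25/192 = (5/4)\<^sup>2 / 12\<close>.\<close>
    have "\<bar>g - 5 / 4\<bar> \<le> 5 / 4" unfolding abs_le_iff using mid \<open>0 \<le> g\<close> by linarith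
    then have "\<bar>g - 5 / 4\<bar>\<^sup>2 \<le> (5 / 4)\<^sup>2" by (intro power_mono) auto
    also have "\<dots> \<le> 12 * a" using mid by (simp add: power_divide)
    finally have "(g - 5 / 4)\<^sup>2 \<le> 12 * a" by simp
    then show ?thesis by (intro crit[of "3 / 2"]) (simp_all add: power_divide)
  next
    case near
    have "\<bar>g - 8 * a + 12 * a\<^sup>2\<bar> \<le> 8 * a * (1 - 2 * a)"
    proof (rule abs_leI)
      show "- (g - 8 * a + 12 * a\<^sup>2) \<le> 8 * a * (1 - 2 * a)"
        using g_ge by (simp add: algebra_simps power2_eq_square)
      have "28 * (a * a) \<le> 12 * a" using near a by simp
      then show "g - 8 * a + 12 * a\<^sup>2 \<le> 8 * a * (1 - 2 * a)"
        using near by (simp add: algebra_simps power2_eq_square)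
    qed
    then have "\<bar>g - 8 * a + 12 * a\<^sup>2\<bar>\<^sup>2 \<le> (8 * a * (1 - 2 * a))\<^sup>2" by (intro power_mono) auto
    also have "\<dots> = 64 * a\<^sup>2 * (1 - 2 * a) * (1 - 2 * a)" by algebra
    also have "\<dots> \<le> 64 * a\<^sup>2 * (1 - 2 * a) * (1 + 2 * a)"
      using near a by (intro mult_left_mono) auto
    finally have bound: "(g - 8 * a + 12 * a\<^sup>2)\<^sup>2 \<le> 64 * a\<^sup>2 * (1 - 2 * a) * (1 + 2 * a)" by simp
    have eqs: "1 + g - 12 * a + 8 * (1 + 2 * a) * a - (1 + 2 * a)\<^sup>2 = g - 8 * a + 12 * a\<^sup>2"
      "32 * a * (1 + 2 * a) * ((1 + 2 * a - 1) * (2 - (1 + 2 * a))) = 64 * a\<^sup>2 * (1 - 2 * a) * (1 + 2 * a)"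
      by algebra+
    show ?thesis
      by (rule crit[of "1 + 2 * a"], use a in simp, unfold eqs, rule bound)
  next
    case far
    define s where "s = sqrt (1 + g)"
    have s2: "s\<^sup>2 = 1 + g" using far a by (simp add: s_def)
    have "1 < s" using far a by (simp add: s_def)
    \<comment> \<open>\<open>s\<^sup>2 < 13/4 < 1.81\<^sup>2\<close>; on \<open>[1, 1.81]\<close> the cubic \<open>8 s (2 - s) - (s + 1) (2 s - 3)\<^sup>2 = 19 s - 9 - 4 s\<^sup>3\<close>
      is nonnegative.\<close>
    have "s < 181 / 100" by (rule power2_less_imp_less) (use far in \<open>simp_all add: s2 power_divide\<close>)
    have "0 \<le> (s - 1) * (181 / 100 - s)" using \<open>1 < s\<close> \<open>s < 181 / 100\<close> by simp
    also have "(s - 1) * (181 / 100 - s) = 281 / 100 * s - 181 / 100 - s * s" by algebra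
    finally have q: "s * s \<le> 281 / 100 * s - 181 / 100" by simp
    have "s * (s * s) \<le> s * (281 / 100 * s - 181 / 100)" using q \<open>1 < s\<close> by (intro mult_left_mono) auto
    then have "(s + 1) * (2 * s - 3)\<^sup>2 \<le> 8 * s * (2 - s)"
      using q \<open>1 < s\<close> \<open>s < 181 / 100\<close> by (simp add: algebra_simps power2_eq_square)
    then have cubic: "(s - 1) * ((s + 1) * (2 * s - 3)\<^sup>2) \<le> (s - 1) * (8 * s * (2 - s))"
      using \<open>1 < s\<close> by (intro mult_left_mono) auto
    have "4 * a * (2 * s - 3)\<^sup>2 \<le> g * (2 * s - 3)\<^sup>2"
      using far by (intro mult_right_mono) auto
    also have "g = (s - 1) * (s + 1)" using s2 by algebra
    also have "(s - 1) * (s + 1) * (2 * s - 3)\<^sup>2 \<le> (s - 1) * (8 * s * (2 - s))"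
      using cubic by (simp only: mult.assoc)
    finally have "4 * a * (2 * s - 3)\<^sup>2 \<le> (s - 1) * (8 * s * (2 - s))" .
    then have "(4 * a) * (4 * a * (2 * s - 3)\<^sup>2) \<le> (4 * a) * ((s - 1) * (8 * s * (2 - s)))"
      using a by (intro mult_left_mono) auto
    moreover have "1 + g - 12 * a + 8 * s * a - s\<^sup>2 = 4 * a * (2 * s - 3)"
      unfolding s2 by algebra
    ultimately show ?thesis using \<open>1 < s\<close>
      by (intro crit[of s]) (simp_all add: power_mult_distrib power2_eq_square algebra_simps)
  qed
qed

section \<open>The norm inequality\<close>

lemma den_op_eq:
  assumes "bounded_clinear T"
  shows "den_op c T y = (1 + c) *\<^sub>C (T (T (T (T y))) + y) + (2 * (1 - c)) *\<^sub>C T (T y)"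
  unfolding scaleC_double
  by (simp add: den_op_def numeral_2_eq_2 bounded_clinear_add[OF assms] bounded_clinear_diff[OF assms]
      scaleC_add_right scaleC_diff_right scaleC_add_left scaleC_diff_left scaleC_one
      algebra_simps)

lemma num_op_eq:
  assumes "bounded_clinear T"
  shows "num_op c T y = (1 + cnj c) *\<^sub>C (T (T (T (T y))) + y) + (2 * (cnj c - 1)) *\<^sub>C T (T y)"
  unfolding scaleC_double
  by (simp add: num_op_def numeral_2_eq_2 bounded_clinear_add[OF assms] bounded_clinear_diff[OF assms]
      scaleC_add_right scaleC_diff_right scaleC_add_left scaleC_diff_left scaleC_one
      algebra_simps)

text \<open>
  The same computation with a constant \<open>K > 1\<close> in place of \<open>sqrt 2\<close> leads to the same points
  \<open>(a, b, d)\<close>, with \<open>2 (K\<^sup>2 + 1) / (K\<^sup>2 - 1)\<close> in place of the coefficient \<open>6\<close> of \<open>plane_form\<close>.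
\<close>
lemma num_den_defect:
  assumes T: "bounded_clinear T" and c: "norm c < 1"
  defines "\<kappa> \<equiv> 1 - (norm c)\<^sup>2"
  defines "a \<equiv> (norm (1 + c))\<^sup>2 / (2 * \<kappa>)" and "b \<equiv> - 2 * Im c / \<kappa>"
    and "d \<equiv> 2 * (norm (1 - c))\<^sup>2 / \<kappa>"
  shows "2 * (norm (den_op c T y))\<^sup>2 - (norm (num_op c T y))\<^sup>2
      = 2 * \<kappa> * plane_form a b d (T (T (T (T y))) + y) (T (T y))"
    and "0 < \<kappa>" "0 < a" "a * d = 1 + b\<^sup>2"
proof -
  have "(norm c)\<^sup>2 < 1\<^sup>2" using c by (intro power_strict_mono) auto
  then show \<kappa>: "0 < \<kappa>" by (simp add: \<kappa>_def)
  define u v where "u = Re c" and "v = Im c"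
  have ceq: "c = Complex u v" by (simp add: u_def v_def)
  have \<kappa>': "\<kappa> = 1 - u\<^sup>2 - v\<^sup>2" by (simp add: \<kappa>_def cmod_power2 u_def v_def)
  have n1: "(norm (1 + c))\<^sup>2 = (1 + u)\<^sup>2 + v\<^sup>2" "(norm (1 - c))\<^sup>2 = (1 - u)\<^sup>2 + v\<^sup>2"
    by (simp_all add: cmod_power2 u_def v_def)
  have "1 + c \<noteq> 0" using c by (auto simp: add_eq_0_iff)
  then show "0 < a" using \<kappa> by (simp add: a_def)
  have "4 * \<kappa>\<^sup>2 * (a * d) = 4 * ((norm (1 + c))\<^sup>2 * (norm (1 - c))\<^sup>2)"
    using \<kappa> by (simp add: a_def d_def power2_eq_square)
  also have "\<dots> = 4 * \<kappa>\<^sup>2 + 4 * (2 * v)\<^sup>2"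
    unfolding n1 \<kappa>' by algebra
  also have "\<dots> = 4 * \<kappa>\<^sup>2 * (1 + b\<^sup>2)"
    using \<kappa> by (simp add: b_def v_def power_divide power_mult_distrib distrib_left)
  finally show "a * d = 1 + b\<^sup>2" using \<kappa> by simp
  have scaled: "2 * \<kappa> * a = (1 + u)\<^sup>2 + v\<^sup>2" "2 * \<kappa> * d = 4 * ((1 - u)\<^sup>2 + v\<^sup>2)"
    "2 * \<kappa> * b = - 4 * v"
    using \<kappa> unfolding n1[symmetric] by (simp_all add: a_def b_def d_def v_def)
  define E S where "E = T (T (T (T y))) + y" and "S = T (T y)"
  define X Y where "X = Re (cinner E S)" and "Y = Im (cinner E S)"
  have XY: "cinner E S = Complex X Y" by (simp add: X_def Y_def)
  have "2 * (norm (den_op c T y))\<^sup>2 - (norm (num_op c T y))\<^sup>2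
    = ((1 + u)\<^sup>2 + v\<^sup>2) * (norm E)\<^sup>2 + 4 * ((1 - u)\<^sup>2 + v\<^sup>2) * (norm S)\<^sup>2 + 12 * \<kappa> * X - 8 * v * Y"
    unfolding den_op_eq[OF T] num_op_eq[OF T] E_def[symmetric]
    unfolding S_def[symmetric] norm_combination XY ceq \<kappa>'
    by (simp add: cmod_power2 norm_mult power_mult_distrib) (simp add: algebra_simps power2_eq_square)
  also have "\<dots> = (2 * \<kappa> * a) * (norm E)\<^sup>2 + (2 * \<kappa> * d) * (norm S)\<^sup>2 + 12 * \<kappa> * X
      + 2 * (2 * \<kappa> * b) * Y"
    unfolding scaled by simp
  also have "\<dots> = 2 * \<kappa> * plane_form a b d E S"
    unfolding plane_form_def X_def Y_def by (simp add: algebra_simps)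
  finally show "2 * (norm (den_op c T y))\<^sup>2 - (norm (num_op c T y))\<^sup>2
      = 2 * \<kappa> * plane_form a b d (T (T (T (T y))) + y) (T (T y))"
    unfolding E_def S_def .
qed

theorem num_op_le_den_op:
  assumes T: "sectorial T" and c: "norm c < 1"
  shows "norm (num_op c T y) \<le> sqrt 2 * norm (den_op c T y)"
proof -
  have "bounded_clinear T" using T by (simp add: sectorial_def)
  note defect = num_den_defect[OF this c]
  have "0 \<le> 2 * (norm (den_op c T y))\<^sup>2 - (norm (num_op c T y))\<^sup>2"
    unfolding defect(1)
    using defect(2) plane_form_hyperboloid_nonneg[OF T defect(3,4)] by (intro mult_nonneg_nonneg) auto
  then have "(norm (num_op c T y))\<^sup>2 \<le> (sqrt 2 * norm (den_op c T y))\<^sup>2"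
    by (simp add: power_mult_distrib)
  then show ?thesis by (rule power2_le_imp_le) simp
qed

section \<open>Invertibility of the denominator\<close>

lemma bounded_clinear_comp:
  "bounded_clinear S \<Longrightarrow> bounded_clinear T \<Longrightarrow> bounded_clinear (S \<circ> T)"
  unfolding bounded_clinear_def comp_def by (simp add: bounded_linear_compose)

lemma op_invertible_comp:
  assumes "op_invertible S" "op_invertible T"
  shows "op_invertible (S \<circ> T)"
proof -
  from assms obtain R Q where
    *: "bounded_clinear S" "bounded_clinear R" "R \<circ> S = id" "S \<circ> R = id"
      "bounded_clinear T" "bounded_clinear Q" "Q \<circ> T = id" "T \<circ> Q = id"
    by (auto simp: op_invertible_def)
  have "bounded_clinear (Q \<circ> R)" using * by (intro bounded_clinear_comp)
  moreover have "(Q \<circ> R) \<circ> (S \<circ> T) = id" "(S \<circ> T) \<circ> (Q \<circ> R) = id"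
    using * by (simp_all add: fun_eq_iff)
  ultimately show ?thesis using * bounded_clinear_comp by (auto simp: op_invertible_def)
qed

lemma bounded_clinear_scale: "bounded_clinear (\<lambda>x::'a::chilbert_space. k *\<^sub>C x)"
  unfolding bounded_clinear_def
proof (intro conjI allI)
  show "bounded_linear (\<lambda>x::'a. k *\<^sub>C x)"
  proof (rule bounded_linear_intro)
    show "k *\<^sub>C (r *\<^sub>R x) = r *\<^sub>R k *\<^sub>C x" for r and x :: 'a
      by (simp add: scaleC_of_real[symmetric] scaleC_scaleC mult.commute)
    show "norm (k *\<^sub>C x) \<le> norm x * norm k" for x :: 'a
      by (simp add: norm_scaleC mult.commute)
  qed (rule scaleC_add_right)
qed (simp add: scaleC_scaleC mult.commute)

lemma op_invertible_scale:
  assumes "k \<noteq> 0"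
  shows "op_invertible (\<lambda>x::'a::chilbert_space. k *\<^sub>C x)"
  unfolding op_invertible_def
proof (intro conjI exI[of _ "\<lambda>x::'a. inverse k *\<^sub>C x"])
  show "(\<lambda>x::'a. inverse k *\<^sub>C x) \<circ> (\<lambda>x. k *\<^sub>C x) = id"
    "(\<lambda>x::'a. k *\<^sub>C x) \<circ> (\<lambda>x. inverse k *\<^sub>C x) = id"
    using assms by (simp_all add: fun_eq_iff scaleC_scaleC scaleC_one)
qed (rule bounded_clinear_scale)+

text \<open>
  The Lax--Milgram lemma, proved without adjoints: for a small step size \<open>\<tau>\<close> the iteration
  \<open>x \<mapsto> x - \<tau> \<omega> (S x - y)\<close> is a contraction, whose fixed point solves \<open>S x = y\<close>.
\<close>
lemma op_invertible_if_coercive: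
  fixes S :: "'a::chilbert_space \<Rightarrow> 'a"
  assumes S: "bounded_clinear S" and \<delta>: "0 < \<delta>"
    and coercive: "\<And>x. \<delta> * (norm x)\<^sup>2 \<le> Re (\<omega> * cinner (S x) x)"
  shows "op_invertible S"
proof -
  interpret bounded_linear S using S by (simp add: bounded_clinear_def)
  obtain K where K: "0 < K" and bound: "\<And>x. norm (S x) \<le> norm x * K"
    using pos_bounded by blast
  \<comment> \<open>A bound for \<open>\<omega> S\<close>, enlarged by \<open>\<delta>\<close> so that it is positive and the contraction factor is real.\<close>
  define L where "L = K * (norm \<omega> + \<delta> / K)"
  have L: "0 < L" "\<delta> \<le> L" using K \<delta> by (simp_all add: L_def distrib_left add_nonneg_pos)
  have LK: "norm \<omega> * K \<le> L" using K \<delta> by (simp add: L_def distrib_left mult.commute)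
  define \<tau> where "\<tau> = \<delta> / L\<^sup>2"
  define q where "q = sqrt (1 - \<delta>\<^sup>2 / L\<^sup>2)"
  have "\<delta>\<^sup>2 \<le> L\<^sup>2" using L \<delta> by (intro power_mono) auto
  then have q01: "0 \<le> q" "q < 1" using L \<delta> by (auto simp: q_def)
  have q2: "q\<^sup>2 = 1 - \<delta>\<^sup>2 / L\<^sup>2" using \<open>\<delta>\<^sup>2 \<le> L\<^sup>2\<close> L by (simp add: q_def)
  have contraction: "norm (u - (\<tau> * \<omega>) *\<^sub>C S u) \<le> q * norm u" for u
  proof (rule power2_le_imp_le)
    have "norm (\<omega> *\<^sub>C S u) \<le> L * norm u"
    proof -
      have "norm (\<omega> *\<^sub>C S u) \<le> norm \<omega> * (norm u * K)"
        unfolding norm_scaleC by (intro mult_left_mono bound) auto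
      also have "\<dots> = norm \<omega> * K * norm u" by simp
      also have "\<dots> \<le> L * norm u" by (intro mult_right_mono LK) auto
      finally show ?thesis .
    qed
    then have "(norm \<omega> * norm (S u))\<^sup>2 \<le> (L * norm u)\<^sup>2"
      unfolding norm_scaleC[symmetric] by (intro power_mono) auto
    then have b: "\<tau>\<^sup>2 * (norm \<omega> * norm (S u))\<^sup>2 \<le> \<tau>\<^sup>2 * (L * norm u)\<^sup>2"
      by (intro mult_left_mono) auto
    have "u - (\<tau> * \<omega>) *\<^sub>C S u = (- (\<tau> * \<omega>)) *\<^sub>C S u + 1 *\<^sub>C u"
      by (simp add: diff_eq_scaleC scaleC_scaleC scaleC_one)
    then have "(norm (u - (\<tau> * \<omega>) *\<^sub>C S u))\<^sup>2
        = (\<bar>\<tau>\<bar> * norm \<omega>)\<^sup>2 * (norm (S u))\<^sup>2 + (norm u)\<^sup>2 + 2 * Re (- (\<tau> * (\<omega> * cinner (S u) u)))"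
      by (simp only: norm_combination) (simp add: norm_mult mult.assoc)
    also have "\<dots> = (norm u)\<^sup>2 - 2 * \<tau> * Re (\<omega> * cinner (S u) u) + \<tau>\<^sup>2 * (norm \<omega> * norm (S u))\<^sup>2"
      by (simp add: power_mult_distrib algebra_simps)
    also have "\<dots> \<le> (norm u)\<^sup>2 - 2 * \<tau> * (\<delta> * (norm u)\<^sup>2) + \<tau>\<^sup>2 * (L * norm u)\<^sup>2"
    proof -
      have "2 * \<tau> * (\<delta> * (norm u)\<^sup>2) \<le> 2 * \<tau> * Re (\<omega> * cinner (S u) u)"
        using \<delta> L by (intro mult_left_mono coercive) (simp add: \<tau>_def)
      then show ?thesis using b by linarith
    qed
    also have "\<dots> = (q * norm u)\<^sup>2"
      unfolding power_mult_distrib q2 \<tau>_def using L by (simp add: field_simps power2_eq_square)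
    finally show "(norm (u - (\<tau> * \<omega>) *\<^sub>C S u))\<^sup>2 \<le> (q * norm u)\<^sup>2" .
  qed (use q01 in simp)
  have lower: "\<delta> * norm x \<le> norm \<omega> * norm (S x)" for x
  proof (cases "x = 0")
    case False
    have "\<delta> * (norm x)\<^sup>2 \<le> Re (cinner (\<omega> *\<^sub>C S x) x)" using coercive by (simp add: cinner_scaleC_left)
    also have "\<dots> \<le> norm (\<omega> *\<^sub>C S x) * norm x"
      unfolding inner_eq_Re_cinner[symmetric] by (rule norm_cauchy_schwarz)
    finally have "norm x * (\<delta> * norm x) \<le> norm x * (norm \<omega> * norm (S x))"
      by (simp add: norm_scaleC power2_eq_square mult_ac)
    then show ?thesis using False by simp
  qed (simp add: zero)
  have "\<exists>x. S x = y" for y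
  proof (cases "\<omega> = 0")
    case True
    then have "y = 0" using lower[of y] \<delta> by (simp add: mult_le_0_iff)
    then show ?thesis using zero by blast
  next
    case False
    define f where "f x = x - (\<tau> * \<omega>) *\<^sub>C (S x - y)" for x
    have "dist (f x) (f x') \<le> q * dist x x'" for x x'
    proof -
      have "f x - f x' = (x - x') - (\<tau> * \<omega>) *\<^sub>C S (x - x')"
        by (simp add: f_def diff scaleC_diff_right)
      then show ?thesis using contraction[of "x - x'"] by (simp add: dist_norm)
    qed
    then have "\<exists>!x. x \<in> UNIV \<and> f x = x"
      using Banach_fix[of UNIV q f] q01 by (auto simp: complete_UNIV)
    then obtain x where "(\<tau> * \<omega>) *\<^sub>C (S x - y) = 0" by (auto simp: f_def)
    then have "norm (\<tau> * \<omega>) * norm (S x - y) = 0" by (metis norm_scaleC norm_zero)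
    then have "S x = y" using False \<delta> L by (simp add: \<tau>_def)
    then show ?thesis ..
  qed
  then have surj: "surj S" unfolding surj_def by metis
  have "inj S"
  proof (rule injI)
    fix x y assume "S x = S y"
    then have "\<delta> * norm (x - y) \<le> 0" using lower[of "x - y"] by (simp add: diff)
    then show "x = y" using \<delta> by (simp add: mult_le_0_iff)
  qed
  have SR: "S (inv S x) = x" for x using surj by (simp add: surj_f_inv_f)
  have RS: "inv S (S x) = x" for x using \<open>inj S\<close> by simp
  have "bounded_clinear (inv S)"
    unfolding bounded_clinear_def
  proof (intro conjI allI)
    show "inv S (k *\<^sub>C x) = k *\<^sub>C inv S x" for k x
      using RS[of "k *\<^sub>C inv S x"] by (simp add: bounded_clinear_scaleC[OF S] SR)
    show "bounded_linear (inv S)"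
    proof (rule bounded_linear_intro)
      show "inv S (x + y) = inv S x + inv S y" for x y
        using RS[of "inv S x + inv S y"] by (simp add: add SR)
      show "inv S (r *\<^sub>R x) = r *\<^sub>R inv S x" for r x
        using RS[of "r *\<^sub>R inv S x"] by (simp add: scaleR SR)
      show "norm (inv S x) \<le> norm x * (norm \<omega> / \<delta>)" for x
        using lower[of "inv S x"] \<delta> by (simp add: SR field_simps)
    qed
  qed
  then show ?thesis
    unfolding op_invertible_def using S SR RS by (intro conjI exI[of _ "inv S"]) auto
qed

text \<open>
  If \<open>Re z\<^sup>2 < 0\<close> then \<open>z\<close> or \<open>- z\<close> lies above the diagonals and the other below them. The side form whose
  half-plane misses \<open>z\<close> makes \<open>T - z\<close> coercive.
\<close>
lemma op_invertible_shift:
  assumes T: "sectorial T" and z: "Re (z\<^sup>2) < 0"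
  shows "op_invertible (\<lambda>x. T x - z *\<^sub>C x)"
proof -
  define \<sigma> where "\<sigma> = sgn (Im z)"
  have "(Re z)\<^sup>2 < (Im z)\<^sup>2" using z by (simp add: power2_eq_square)
  then have *: "\<bar>Re z\<bar> < \<bar>Im z\<bar>" by (simp add: abs_le_square_iff flip: not_le)
  then have "Im z \<noteq> 0" by auto
  then have \<sigma>: "\<bar>\<sigma>\<bar> = 1" "\<sigma> * Im z = \<bar>Im z\<bar>" by (auto simp: \<sigma>_def sgn_if)
  have lin: "bounded_clinear T" using T by (simp add: sectorial_def)
  show ?thesis
  proof (rule op_invertible_if_coercive)
    show "bounded_clinear (\<lambda>x. T x - z *\<^sub>C x)"
      using lin bounded_clinear_scale[of z, where 'a='a] unfolding bounded_clinear_def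
      by (simp add: bounded_linear_sub scaleC_diff_right scaleC_scaleC mult.commute)
    show "0 < \<bar>Im z\<bar> - Re z" using * by linarith
    fix x
    have "\<sigma> * Im (cinner (T x) x) \<le> \<bar>Im (cinner (T x) x)\<bar>"
      using abs_ge_self[of "\<sigma> * Im (cinner (T x) x)"] \<sigma> by (simp add: abs_mult)
    also have "\<dots> \<le> Re (cinner (T x) x)" by (rule sectorial_form[OF T])
    finally have "0 \<le> Re (cinner (T x) x) - \<sigma> * Im (cinner (T x) x)" by simp
    moreover have "Re ((1 + \<sigma> * \<i>) * cinner (T x - z *\<^sub>C x) x)
      = (Re (cinner (T x) x) - \<sigma> * Im (cinner (T x) x)) + (\<bar>Im z\<bar> - Re z) * (norm x)\<^sup>2"
      unfolding cinner_diff_left cinner_scaleC_left cinner_self \<sigma>(2)[symmetric]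
      by (simp add: algebra_simps del: of_real_power)
    ultimately show "(\<bar>Im z\<bar> - Re z) * (norm x)\<^sup>2 \<le> Re ((1 + \<sigma> * \<i>) * cinner (T x - z *\<^sub>C x) x)"
      by simp
  qed
qed

lemma op_invertible_square_shift:
  assumes T: "sectorial T" and u: "Re u < 0"
  shows "op_invertible (\<lambda>x. T (T x) - u *\<^sub>C x)"
proof -
  have lin: "bounded_clinear T" using T by (simp add: sectorial_def)
  define z where "z = csqrt u"
  have z: "z\<^sup>2 = u" "(- z)\<^sup>2 = u" by (simp_all add: z_def)
  have "op_invertible ((\<lambda>x. T x - z *\<^sub>C x) \<circ> (\<lambda>x. T x - (- z) *\<^sub>C x))"
    using u by (intro op_invertible_comp op_invertible_shift[OF T]) (simp_all add: z)
  also have "(\<lambda>x. T x - z *\<^sub>C x) \<circ> (\<lambda>x. T x - (- z) *\<^sub>C x) = (\<lambda>x. T (T x) - u *\<^sub>C x)"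
  proof
    fix x
    show "((\<lambda>x. T x - z *\<^sub>C x) \<circ> (\<lambda>x. T x - (- z) *\<^sub>C x)) x = T (T x) - u *\<^sub>C x"
      by (simp add: bounded_clinear_add[OF lin] bounded_clinear_scaleC[OF lin] scaleC_minus_left
        scaleC_add_right scaleC_scaleC z(1)[symmetric] power2_eq_square)
  qed
  finally show ?thesis .
qed

text \<open>
  As a polynomial in \<open>u = z\<^sup>2\<close> the denominator is \<open>(1 + c) (u\<^sup>2 + 2 m u + 1)\<close> with
  \<open>m = (1 - c) / (1 + c)\<close>. Since \<open>Re m > 0\<close> and the roots are inverse to each other, their real parts
  have the same sign and a negative sum.
\<close>
lemma op_invertible_den_op:
  assumes T: "sectorial T" and c: "norm c < 1"
  shows "op_invertible (den_op c T)"
proof -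
  have lin: "bounded_clinear T" using T by (simp add: sectorial_def)
  have c1: "1 + c \<noteq> 0" using c by (auto simp: add_eq_0_iff)
  define m where "m = (1 - c) / (1 + c)"
  have "Re m = (1 - (norm c)\<^sup>2) / (norm (1 + c))\<^sup>2"
    unfolding m_def by (simp add: Re_divide cmod_power2) (simp add: algebra_simps power2_eq_square)
  moreover have "(norm c)\<^sup>2 < 1\<^sup>2" using c by (intro power_strict_mono) auto
  ultimately have m: "0 < Re m" using c1 by simp
  define u v where "u = - m + csqrt (m\<^sup>2 - 1)" and "v = - m - csqrt (m\<^sup>2 - 1)"
  have "csqrt (m\<^sup>2 - 1) * csqrt (m\<^sup>2 - 1) = m\<^sup>2 - 1" by (simp flip: power2_eq_square)
  then have uv: "u * v = 1" unfolding u_def v_def by (simp add: algebra_simps power2_eq_square)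
  have sum: "u + v = - 2 * m" by (simp add: u_def v_def)
  have "v = inverse u" using uv by (metis inverse_unique)
  then have v: "Re v = Re u / (norm u)\<^sup>2" by (simp add: cmod_power2)
  have "Re u + Re v < 0" using arg_cong[OF sum, of Re] m by simp
  moreover have "u \<noteq> 0" using uv by auto
  ultimately have "Re u * (1 + 1 / (norm u)\<^sup>2) < 0" by (simp add: v distrib_left)
  moreover have "0 < 1 + 1 / (norm u)\<^sup>2" by (simp add: add_pos_nonneg)
  ultimately have "Re u < 0" by (simp add: mult_less_0_iff)
  then have "Re v < 0" using \<open>u \<noteq> 0\<close> by (simp add: v divide_less_0_iff)
  have "op_invertible ((\<lambda>x. (1 + c) *\<^sub>C x) \<circ> ((\<lambda>x. T (T x) - u *\<^sub>C x) \<circ> (\<lambda>x. T (T x) - v *\<^sub>C x)))"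
    using c1 \<open>Re u < 0\<close> \<open>Re v < 0\<close>
    by (intro op_invertible_comp op_invertible_scale op_invertible_square_shift[OF T])
  also have "(\<lambda>x. (1 + c) *\<^sub>C x) \<circ> ((\<lambda>x. T (T x) - u *\<^sub>C x) \<circ> (\<lambda>x. T (T x) - v *\<^sub>C x)) = den_op c T"
  proof
    fix x
    have "T (T (T (T x) - v *\<^sub>C x)) - u *\<^sub>C (T (T x) - v *\<^sub>C x)
      = T (T (T (T x))) + (u * v) *\<^sub>C x + (- (u + v)) *\<^sub>C T (T x)"
      by (simp add: bounded_clinear_diff[OF lin] bounded_clinear_scaleC[OF lin]
        scaleC_diff_right scaleC_scaleC scaleC_diff_left scaleC_minus_left)
    also have "\<dots> = T (T (T (T x))) + x + (2 * m) *\<^sub>C T (T x)"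
      unfolding uv sum by (simp add: scaleC_one)
    finally have "(1 + c) *\<^sub>C (T (T (T (T x) - v *\<^sub>C x)) - u *\<^sub>C (T (T x) - v *\<^sub>C x))
      = (1 + c) *\<^sub>C (T (T (T (T x))) + x) + (2 * ((1 + c) * m)) *\<^sub>C T (T x)"
      by (simp add: scaleC_add_right scaleC_scaleC mult_ac)
    also have "(1 + c) * m = 1 - c" using c1 by (simp add: m_def)
    finally show "((\<lambda>x. (1 + c) *\<^sub>C x) \<circ> ((\<lambda>x. T (T x) - u *\<^sub>C x) \<circ> (\<lambda>x. T (T x) - v *\<^sub>C x))) x
        = den_op c T x"
      by (simp add: den_op_eq[OF lin])
  qed
  finally show ?thesis .
qed

section \<open>Admissibility in the closed unit disc\<close>

lemma admissible_interior:
  assumes c: "norm c < 1"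
  shows "admissible TYPE('a::chilbert_space) c"
  unfolding admissible_def
proof (intro allI impI)
  fix T :: "'a \<Rightarrow> 'a"
  assume "bounded_clinear T" "numerical_range T \<subseteq> sector (pi / 4)"
  then have T: "sectorial T" by (simp add: sectorial_def)
  have inv: "op_invertible (den_op c T)" by (rule op_invertible_den_op[OF T c])
  then obtain R where "R \<circ> den_op c T = id" "den_op c T \<circ> R = id"
    by (auto simp: op_invertible_def)
  then have "surj (den_op c T)" by (metis comp_apply id_apply surjI)
  then have "norm ((num_op c T \<circ> Hilbert_Choice.inv (den_op c T)) x) \<le> sqrt 2 * norm x" for x
    using num_op_le_den_op[OF T c, of "Hilbert_Choice.inv (den_op c T) x"] by (simp add: surj_f_inv_f)
  then have "onorm (num_op c T \<circ> Hilbert_Choice.inv (den_op c T)) \<le> sqrt 2"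
    by (intro onorm_bound) auto
  then show "op_invertible (quot_den c T) \<and> onorm (quot_num c T \<circ> Hilbert_Choice.inv (quot_den c T)) \<le> sqrt 2"
    using inv c by (simp add: quot_num_def quot_den_def)
qed

lemma den_poly_nonzero: "den_poly c \<noteq> 0"
proof
  assume "den_poly c = 0"
  then have "poly (den_poly c) 1 = 0" by simp
  then show False by (simp add: den_poly_def)
qed

lemma num_poly_unimodular:
  assumes "norm c = 1"
  shows "num_poly c = smult (cnj c) (den_poly c)"
proof -
  have "cnj c * c = 1" using assms by (simp add: mult.commute complex_norm_square[symmetric])
  then show ?thesis by (simp add: num_poly_def den_poly_def smult_add_right add.commute)
qed

lemma op_poly_const: "op_poly [:k:] T = (\<lambda>x. k *\<^sub>C x)"
  by (simp add: op_poly_def)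

text \<open>
  Numerator and denominator are proportional, so after cancellation both are nonzero scalars. The
  gcd is normalized, hence the denominator becomes its leading coefficient and not \<open>1\<close>.
\<close>
lemma admissible_circle:
  assumes c: "norm c = 1"
  shows "admissible TYPE('a::chilbert_space) c"
  unfolding admissible_def
proof (intro allI impI)
  fix T :: "'a \<Rightarrow> 'a"
  let ?n = "num_poly c" and ?d = "den_poly c"
  have "is_unit (unit_factor ?d)" using den_poly_nonzero by simp
  then obtain k where k: "unit_factor ?d = [:k:]" "k \<noteq> 0"
    by (metis is_unit_poly_iff not_is_unit_0)
  have "?d dvd ?n" unfolding num_poly_unimodular[OF c] by (rule dvd_smult) simp
  then have "gcd ?n ?d = normalize ?d" by (rule gcd_proj2_if_dvd)
  then have "?d div gcd ?n ?d = [:k:]" "?n div gcd ?n ?d = [:cnj c * k:]"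
    using k(1) by (simp_all add: num_poly_unimodular[OF c] div_smult_left)
  then have quot: "quot_den c T = (\<lambda>x. k *\<^sub>C x)" "quot_num c T = (\<lambda>x. (cnj c * k) *\<^sub>C x)"
    using c by (simp_all add: quot_num_def quot_den_def op_poly_const)
  have "surj (\<lambda>x::'a. k *\<^sub>C x)"
    using k(2) by (intro surjI[of _ "\<lambda>x. inverse k *\<^sub>C x"]) (simp add: scaleC_scaleC scaleC_one)
  then have "k *\<^sub>C inv (\<lambda>x::'a. k *\<^sub>C x) x = x" for x by (rule surj_f_inv_f)
  then have "norm ((quot_num c T \<circ> inv (quot_den c T)) x) \<le> 1 * norm x" for x
    using c by (simp add: quot scaleC_scaleC[symmetric] norm_scaleC)
  then have "onorm (quot_num c T \<circ> inv (quot_den c T)) \<le> 1"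
    by (intro onorm_bound) auto
  moreover have "op_invertible (quot_den c T)" unfolding quot by (rule op_invertible_scale[OF k(2)])
  moreover have "1 \<le> sqrt 2" by simp
  ultimately show "op_invertible (quot_den c T) \<and> onorm (quot_num c T \<circ> inv (quot_den c T)) \<le> sqrt 2"
    by linarith
qed

theorem admissible_closed_disc:
  "norm c \<le> 1 \<Longrightarrow> admissible TYPE('a::chilbert_space) c"
  using admissible_interior admissible_circle by (cases "norm c = 1") auto

section \<open>The covered arcs\<close>

lemma s_par_eq: "t \<noteq> 0 \<Longrightarrow> s_par t = 1 / (2 * t\<^sup>2) - 2 * t\<^sup>2"
  by (simp add: s_par_def field_simps power4_eq_xxxx power2_eq_square)

lemma s_par_strict_antimono: "strict_antimono_on {0<..} s_par"
proof (rule monotone_onI)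
  fix x y :: real
  assume "x \<in> {0<..}" "y \<in> {0<..}" and "x < y"
  then have "0 < x" by simp
  have sq: "x\<^sup>2 < y\<^sup>2" using \<open>0 < x\<close> \<open>x < y\<close> by (intro power_strict_mono) auto
  then have "1 / (2 * y\<^sup>2) < 1 / (2 * x\<^sup>2)" using \<open>0 < x\<close> \<open>x < y\<close> by (intro divide_strict_left_mono) auto
  then show "s_par y < s_par x" using sq \<open>0 < x\<close> \<open>x < y\<close> by (simp add: s_par_eq)
qed

lemma s_par_tenth: "s_par (1/10) = 2499/50"
  by (simp add: s_par_def power_divide)

lemma s_par_inverse_sqrt_2: "s_par (1 / sqrt 2) = 0"
proof -
  have "(1 / sqrt 2)\<^sup>2 = 1 / 2" by (simp add: power_divide)
  then have "(1 / sqrt 2) ^ 4 = 1 / 4" by (simp add: power4_eq_xxxx power2_eq_square)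
  then show ?thesis by (simp add: s_par_def)
qed

lemma zeta_par_eq_cis: "zeta_par t = cis (2 * arctan (s_par t / 2))"
proof -
  define x where "x = s_par t / 2"
  have pos: "0 < 1 + x\<^sup>2" by (simp add: add_pos_nonneg)
  have "cis (2 * arctan x) = Complex ((1 - x\<^sup>2) / (1 + x\<^sup>2)) (2 * x / (1 + x\<^sup>2))"
    using pos by (simp add: complex_eq_iff cos_double sin_double cos_arctan sin_arctan power_divide
        diff_divide_distrib)
  also have "\<dots> = (4 - of_real (2 * x) ^ 2 + 4 * \<i> * of_real (2 * x)) / (4 + of_real (2 * x) ^ 2)"
  proof -
    have den: "4 + complex_of_real (2 * x) ^ 2 = of_real (4 * (1 + x\<^sup>2))"
      by (simp add: power_mult_distrib)
    have num: "4 - complex_of_real (2 * x) ^ 2 + 4 * \<i> * of_real (2 * x)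
        = Complex (4 * (1 - x\<^sup>2)) (4 * (2 * x))"
      by (simp add: complex_eq_iff power_mult_distrib)
    show ?thesis unfolding den num
      by (simp only: complex_eq_iff Re_divide_of_real Im_divide_of_real complex.sel mult_divide_mult_cancel_left_if) simp
  qed
  finally show ?thesis by (simp add: zeta_par_def x_def)
qed

text \<open>
  By the intermediate value theorem \<open>s_par\<close> takes on \<open>{1/10..18/25}\<close> all values in \<open>{0..2499/50}\<close>:
  \<open>s_par\<close> vanishes at \<open>1 / sqrt 2\<close>, just before \<open>18/25\<close>. The negative angles come from the conjugate arc.
\<close>
lemma covered_arcs_eq_cis:
  "covered_arcs = cis ` {- (2 * arctan (2499/100)) .. 2 * arctan (2499/100)}" (is "_ = cis ` {- ?A .. ?A}")
proof (rule set_eqI iffI)+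
  fix z assume "z \<in> covered_arcs"
  then obtain t where t: "1/10 \<le> t" "t \<le> 18/25" and z: "z = zeta_par t \<or> z = cnj (zeta_par t)"
    by (auto simp: covered_arcs_def)
  have anti: "s_par y \<le> s_par x" if "0 < x" "x \<le> y" for x y
    using that monotone_onD[OF s_par_strict_antimono, of x y] by (cases "x = y") auto
  have "s_par t \<le> 2499/50" using anti[of "1/10" t] t by (simp add: s_par_tenth)
  moreover have "- 2499/50 \<le> s_par t"
  proof -
    have "- 2499/50 \<le> s_par (18/25)" by (simp add: s_par_def power_divide)
    then show ?thesis using anti[of t "18/25"] t by simp
  qed
  ultimately have "arctan (s_par t / 2) \<le> arctan (2499/100)"
    "arctan (- (2499/100)) \<le> arctan (s_par t / 2)"
    unfolding arctan_le_iff by simp_all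
  then have "2 * arctan (s_par t / 2) \<in> {- ?A .. ?A}" "- (2 * arctan (s_par t / 2)) \<in> {- ?A .. ?A}"
    by (simp_all add: arctan_minus)
  then show "z \<in> cis ` {- ?A .. ?A}" using z by (auto simp: zeta_par_eq_cis cis_cnj)
next
  fix z assume "z \<in> cis ` {- ?A .. ?A}"
  then obtain \<theta> where z: "z = cis \<theta>" and \<theta>: "\<bar>\<theta>\<bar> \<le> ?A" by (auto simp: abs_le_iff)
  have "?A < pi" using arctan_ubound[of "2499/100"] by simp
  define y where "y = 2 * tan (\<bar>\<theta>\<bar> / 2)"
  have at: "arctan (y / 2) = \<bar>\<theta>\<bar> / 2" unfolding y_def using \<theta> \<open>?A < pi\<close> by (simp add: arctan_tan)
  have "arctan 0 \<le> arctan (y / 2)" "arctan (y / 2) \<le> arctan (2499/100)" using \<theta> by (simp_all add: at)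
  then have y: "0 \<le> y" "y \<le> 2499/50" unfolding arctan_le_iff by simp_all
  have "continuous_on {1/10..18/25} s_par"
    unfolding s_par_def by (intro continuous_intros) auto
  moreover have "s_par (18/25) \<le> 0" by (simp add: s_par_def power_divide)
  ultimately obtain t where t: "1/10 \<le> t" "t \<le> 18/25" "s_par t = y"
    using IVT2'[of s_par "18/25" y "1/10"] y by (auto simp: s_par_tenth)
  have "zeta_par t = cis \<bar>\<theta>\<bar>" by (simp add: zeta_par_eq_cis t at)
  then have "z = zeta_par t \<or> z = cnj (zeta_par t)" by (simp add: z cis_cnj abs_if)
  then show "z \<in> covered_arcs" using t by (auto simp: covered_arcs_def)
qed

lemma sphere_minus_arc_eq_cis:
  assumes B: "0 < B" "B \<le> pi"
  shows "sphere 0 1 - circle_arc (- 1) (2 * B) = cis ` {- (pi - B) .. pi - B}"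
proof (rule set_eqI iffI)+
  fix z assume z: "z \<in> sphere 0 1 - circle_arc (- 1) (2 * B)"
  define \<theta> where "\<theta> = Arg z"
  have "z \<noteq> 0" using z by auto
  then have \<theta>: "z = cis \<theta>" "- pi < \<theta>" "\<theta> \<le> pi"
    using z Arg_eq[of z] Arg_bounded[of z] by (auto simp: \<theta>_def cis_conv_exp mult.commute)
  have arc: "- cis \<phi> \<in> circle_arc (- 1) (2 * B)" if "\<bar>\<phi>\<bar> < B" for \<phi>
    using that by (auto simp: circle_arc_def)
  have shift: "cis \<theta> = - cis (\<theta> - pi)" "cis \<theta> = - cis (\<theta> + pi)"
    by (simp_all add: complex_eq_iff cos_diff sin_diff)
  have "\<theta> \<le> pi - B"
  proof (rule ccontr)
    assume "\<not> \<theta> \<le> pi - B"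
    then have "\<bar>\<theta> - pi\<bar> < B" using \<theta> by linarith
    then show False using arc[of "\<theta> - pi"] z shift \<theta>(1) by auto
  qed
  moreover have "- (pi - B) \<le> \<theta>"
  proof (rule ccontr)
    assume "\<not> - (pi - B) \<le> \<theta>"
    then have "\<bar>\<theta> + pi\<bar> < B" using \<theta> by linarith
    then show False using arc[of "\<theta> + pi"] z shift \<theta>(1) by auto
  qed
  ultimately show "z \<in> cis ` {- (pi - B) .. pi - B}" using \<theta>(1) by auto
next
  fix z assume "z \<in> cis ` {- (pi - B) .. pi - B}"
  then obtain \<theta> where z: "z = cis \<theta>" and \<theta>: "\<bar>\<theta>\<bar> \<le> pi - B" by (auto simp: abs_le_iff)
  have "z \<notin> circle_arc (- 1) (2 * B)"
  proof
    assume "z \<in> circle_arc (- 1) (2 * B)"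
    then obtain \<phi> where "cis \<theta> = - cis \<phi>" and \<phi>: "\<bar>\<phi>\<bar> < B" by (auto simp: circle_arc_def z)
    then have "cos \<theta> = - cos \<phi>" "sin \<theta> = - sin \<phi>" by (auto simp: complex_eq_iff)
    then have "cos (\<theta> - \<phi>) = - ((cos \<phi>)\<^sup>2 + (sin \<phi>)\<^sup>2)" by (simp only: cos_diff power2_eq_square)
    then have "cos \<bar>\<theta> - \<phi>\<bar> = cos pi" by simp
    moreover have "\<bar>\<theta> - \<phi>\<bar> < pi" using \<theta> \<phi> by linarith
    then have "cos pi < cos \<bar>\<theta> - \<phi>\<bar>" by (intro cos_monotone_0_pi) auto
    ultimately show False by simp
  qed
  then show "z \<in> sphere 0 1 - circle_arc (- 1) (2 * B)" by (simp add: z)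
qed

lemma covered_arcs_eq:
  "covered_arcs = sphere 0 1 - circle_arc (-1) (4 * arctan (100/2499))"
proof -
  have "arctan (2499/100) = pi / 2 - arctan (100/2499)"
    using arctan_inverse[of "100/2499"] by simp
  then have "2 * arctan (2499/100) = pi - 2 * arctan (100/2499)" by simp
  moreover have "0 < arctan (100/2499)" by (simp add: zero_less_arctan_iff)
  moreover have "arctan (100/2499) < pi / 2" by (rule arctan_ubound)
  ultimately show ?thesis
    using sphere_minus_arc_eq_cis[of "2 * arctan (100/2499)"] by (simp add: covered_arcs_eq_cis)
qed


theorem theorem1p8:
  shows "(\<forall>\<rho> t c. 0 \<le> \<rho> \<and> \<rho> \<le> 1 \<and> 1/10 \<le> t \<and> t \<le> 18/25 \<and> c = complex_of_real \<rho> * zeta_par t \<longrightarrow>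
            admissible TYPE('a::chilbert_space) c \<and> admissible TYPE('a) (cnj c)) \<and>
         strict_antimono_on {0<..} s_par \<and>
         s_par (1/10) = 2499/50 \<and> s_par (1 / sqrt 2) = 0 \<and>
         covered_arcs = sphere 0 1 - circle_arc (-1) (4 * arctan (100/2499)) \<and>
         (\<forall>\<zeta>\<in>covered_arcs. \<forall>\<rho>\<in>{0..1}. admissible TYPE('a) (complex_of_real \<rho> * \<zeta>))"
proof -
  have zeta: "norm (zeta_par t) = 1" for t by (simp add: zeta_par_eq_cis)
  have "admissible TYPE('a) (complex_of_real \<rho> * z)"
    if "0 \<le> \<rho>" "\<rho> \<le> 1" "norm z = 1" for \<rho> z
    using that by (intro admissible_closed_disc) (simp add: norm_mult)
  moreover have "norm z = 1" if "z \<in> covered_arcs" for z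
    using that by (auto simp: covered_arcs_def zeta)
  ultimately show ?thesis
    using zeta
    by (auto simp: s_par_strict_antimono s_par_tenth s_par_inverse_sqrt_2 covered_arcs_eq)
qed

end
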